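(* Let $X$ be a poset and $K$ a field. If the set $\{(x,y)\in X\times X\mid x<y\}$ is finite, then any unital bijective linear invertibility preserver $\varphi$ of $FI(X,K)$ is strong.
   Context: The finitary incidence algebra $FI(X,K)$ of a poset $(X,\le)$ over a field $K$ is the $K$-space of formal sums $\alpha=\sum_{x\le y}\alpha_{xy}e_{xy}$ ($x,y\in X$, $\alpha_{xy}\in K$, $e_{xy}$ symbols) such that for all $x<y$ the set of pairs $(u,v)$ with $x\le u<v\le y$ and $\alpha_{uv}\neq 0$ is finite. The product is $\alpha\beta=\sum_{x\le y}\big(\sum_{x\le z\le y}\alpha_{xz}\beta_{zy}\big)e_{xy}$; it is a unital associative algebra with identity $\delta=\sum_{x\in X}e_{xx}$. A map $\varphi:A\to A$ on a unital associative algebra $A$ is an invertibility preserver of $A$ if $\varphi(U(A))\subseteq U(A)$, where $U(A)$ is the group of units; it is unital if $\varphi(1_A)=1_A$. An invertibility preserver $\varphi$ of $A$ is strong if for all $a\in A$: $a\in U(A)\iff\varphi(a)\in U(A)$. Linear means $K$-linear. *)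

theory Defs
  imports "HOL-Algebra.Module"
begin

text \<open>
  A poset is a subset \<open>X\<close> of an ordered type, with the induced order; taking an arbitrary subset
  rather than the whole type keeps the empty poset.  A formal sum is represented by its
  coefficient function, which vanishes off the pairs \<open>x \<le> y\<close> in \<open>X\<close>.
\<close>

definition FI_carrier :: "'x::order set \<Rightarrow> ('x \<Rightarrow> 'x \<Rightarrow> 'k::field) set" where
  "FI_carrier X = {\<alpha>.
     (\<forall>x y. \<alpha> x y \<noteq> 0 \<longrightarrow> x \<in> X \<and> y \<in> X \<and> x \<le> y) \<and>
     (\<forall>x\<in>X. \<forall>y\<in>X. x < y \<longrightarrow>
        finite {(u, v). u \<in> X \<and> v \<in> X \<and> x \<le> u \<and> u < v \<and> v \<le> y \<and> \<alpha> u v \<noteq> 0})}"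

text \<open>
  Intervals of \<open>X\<close> may be infinite, and a sum over an infinite set is \<open>0\<close> by convention.  The index
  set is therefore cut down to the nonzero summands, which are finitely many
  (\<open>finite_FI_mult_support\<close>).
\<close>

definition FI_mult ::
  "'x::order set \<Rightarrow> ('x \<Rightarrow> 'x \<Rightarrow> 'k::field) \<Rightarrow> ('x \<Rightarrow> 'x \<Rightarrow> 'k) \<Rightarrow> ('x \<Rightarrow> 'x \<Rightarrow> 'k)" where
  "FI_mult X \<alpha> \<beta> = (\<lambda>x y.
     if x \<in> X \<and> y \<in> X \<and> x \<le> y
     then \<Sum>z | z \<in> X \<and> x \<le> z \<and> z \<le> y \<and> \<alpha> x z * \<beta> z y \<noteq> 0. \<alpha> x z * \<beta> z y
     else 0)"

definition FI :: "'x::order set \<Rightarrow> ('k::field, 'x \<Rightarrow> 'x \<Rightarrow> 'k) module" where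
  "FI X = \<lparr>carrier = FI_carrier X,
           mult = FI_mult X,
           one = (\<lambda>x y. if x \<in> X \<and> x = y then 1 else 0),
           zero = (\<lambda>x y. 0),
           add = (\<lambda>\<alpha> \<beta> x y. \<alpha> x y + \<beta> x y),
           smult = (\<lambda>c \<alpha> x y. c * \<alpha> x y)\<rparr>"

lemma finite_FI_mult_support:
  assumes "\<alpha> \<in> FI_carrier X" "x \<in> X" "y \<in> X"
  shows "finite {z. z \<in> X \<and> x \<le> z \<and> z \<le> y \<and> \<alpha> x z * \<beta> z y \<noteq> 0}" (is "finite ?S")
proof (cases "x < y")
  case True
  let ?P = "{(u, v). u \<in> X \<and> v \<in> X \<and> x \<le> u \<and> u < v \<and> v \<le> y \<and> \<alpha> u v \<noteq> 0}"
  have "finite ?P"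
    using assms True unfolding FI_carrier_def by blast
  moreover have "?S \<subseteq> insert x (snd ` ?P)"
    using \<open>x \<in> X\<close> by (force simp: image_iff order_le_less)
  ultimately show ?thesis
    by (meson finite_imageI finite_insert finite_subset)
next
  case False
  then have "?S \<subseteq> {x}"
    by (auto simp: order_le_less)
  then show ?thesis
    by (rule finite_subset) simp
qed

text \<open>The field of scalars is the whole type \<open>'k\<close>, hence the unrestricted quantifier over \<open>c\<close>.\<close>

definition linear_endo :: "('k, 'a, 'm) module_scheme \<Rightarrow> ('a \<Rightarrow> 'a) \<Rightarrow> bool" where
  "linear_endo A \<phi> \<longleftrightarrow>
     \<phi> \<in> carrier A \<rightarrow> carrier A \<and>
     (\<forall>a\<in>carrier A. \<forall>b\<in>carrier A. \<phi> (a \<oplus>\<^bsub>A\<^esub> b) = \<phi> a \<oplus>\<^bsub>A\<^esub> \<phi> b) \<and>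
     (\<forall>c. \<forall>a\<in>carrier A. \<phi> (c \<odot>\<^bsub>A\<^esub> a) = c \<odot>\<^bsub>A\<^esub> \<phi> a)"

definition unital_map :: "('a, 'm) monoid_scheme \<Rightarrow> ('a \<Rightarrow> 'a) \<Rightarrow> bool" where
  "unital_map A \<phi> \<longleftrightarrow> \<phi> \<one>\<^bsub>A\<^esub> = \<one>\<^bsub>A\<^esub>"

definition invertibility_preserver :: "('a, 'm) monoid_scheme \<Rightarrow> ('a \<Rightarrow> 'a) \<Rightarrow> bool" where
  "invertibility_preserver A \<phi> \<longleftrightarrow>
     \<phi> \<in> carrier A \<rightarrow> carrier A \<and> \<phi> ` Units A \<subseteq> Units A"

definition strong_invertibility_preserver :: "('a, 'm) monoid_scheme \<Rightarrow> ('a \<Rightarrow> 'a) \<Rightarrow> bool" where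
  "strong_invertibility_preserver A \<phi> \<longleftrightarrow>
     invertibility_preserver A \<phi> \<and> (\<forall>a\<in>carrier A. a \<in> Units A \<longleftrightarrow> \<phi> a \<in> Units A)"

end

theory Submission
  imports Defs "HOL.Vector_Spaces" "HOL-Library.Function_Algebras"
begin

text \<open>
  An element of \<open>FI X\<close> is invertible iff its diagonal has no zero, so adding an element of the
  finite-dimensional space \<open>J\<close> of elements with zero diagonal does not affect invertibility.  Hence
  for each \<open>x\<close> the functional \<open>a \<mapsto> \<phi> a x x\<close> vanishes on \<open>J\<close>: otherwise it would have a zero on a
  line \<open>\<one> + t j\<close> of units.  So \<open>\<phi>\<close> maps \<open>J\<close> into \<open>J\<close>, and, being injective, onto \<open>J\<close>.

  Let \<open>a\<close> be a non-unit, and let \<open>b \<notin> J\<close> be the diagonal idempotent of the zeros on the diagonal of \<open>a\<close>.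
  Then \<open>\<phi> b \<notin> J\<close>, say \<open>\<phi> b x x \<noteq> 0\<close>.  Since \<open>a + t b\<close> is a unit for all \<open>t \<noteq> 0\<close>, the only possible
  zero of \<open>t \<mapsto> \<phi> a x x + t (\<phi> b x x)\<close> is \<open>t = 0\<close>, so \<open>\<phi> a x x = 0\<close> and \<open>\<phi> a\<close> is a non-unit.
\<close>

section \<open>Injective endomorphisms of finite-dimensional spaces\<close>

text \<open>A basis \<open>C\<close> of the span goes to an independent set of the same size, which
  must again be a basis. Linearity is asked for on \<open>span B\<close> alone because the maps of
  interest are linear on a carrier and arbitrary elsewhere.\<close>

lemma (in vector_space) injective_endo_surj_on_span:
  assumes "finite B"
    and add: "\<And>u v. u \<in> span B \<Longrightarrow> v \<in> span B \<Longrightarrow> f (u + v) = f u + f v"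
    and scl: "\<And>c u. u \<in> span B \<Longrightarrow> f (scale c u) = scale c (f u)"
    and into: "f ` span B \<subseteq> span B"
    and ker: "\<And>u. u \<in> span B \<Longrightarrow> f u = 0 \<Longrightarrow> u = 0"
  shows "f ` span B = span B"
proof
  obtain C where C: "C \<subseteq> B" "independent C" "B \<subseteq> span C"
    using maximal_independent_subset[of B] by blast
  have sC: "span C = span B"
    using C by (meson span_mono span_minimal subspace_span subset_antisym)
  have fC: "finite C"
    using C(1) \<open>finite B\<close> by (rule finite_subset)
  have CB: "C \<subseteq> span B"
    using sC span_superset by blast
  have f0: "f 0 = 0"
    using scl[of 0 0] span_zero by simp
  have f_sum: "f (\<Sum>c\<in>A. scale (r c) c) = (\<Sum>c\<in>A. scale (r c) (f c))" if "A \<subseteq> C" for A r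
    using finite_subset[OF that fC] that
  proof (induction A rule: finite_induct)
    case empty
    then show ?case by (simp add: f0)
  next
    case (insert c A)
    have "scale (r c) c \<in> span B" "(\<Sum>c\<in>A. scale (r c) c) \<in> span B" "c \<in> span B"
      using insert.prems CB by (auto intro!: span_scale span_sum)
    with insert show ?case by (simp add: add scl)
  qed
  have inj: "inj_on f C"
  proof (rule inj_onI)
    fix u v assume uv: "u \<in> C" "v \<in> C" "f u = f v"
    then have "u \<in> span B" "v \<in> span B" using CB by auto
    \<comment> \<open>The difference is written with \<open>+\<close> and \<open>scale\<close>
      because \<open>add\<close> and \<open>scl\<close> are the only rules for
      \<open>f\<close>.\<close>
    then have "f (u + scale (-1) v) = 0" "u + scale (-1) v \<in> span B"
      using uv by (simp_all only: add scl span_add span_scale) simp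
    then have "u + scale (-1) v = 0" by (rule ker[rotated])
    then show "u = v" by simp
  qed
  \<comment> \<open>A vanishing combination of the images is the image of the combination of
    \<open>C\<close> with the pulled-back coefficients, so \<open>ker\<close> applies to the
    latter.\<close>
  have ind: "independent (f ` C)"
  proof (rule independent_if_scalars_zero)
    show "finite (f ` C)" using fC by simp
    fix g w assume g: "(\<Sum>x\<in>f ` C. scale (g x) x) = 0" and "w \<in> f ` C"
    then obtain c where c: "c \<in> C" "w = f c" by blast
    have "f (\<Sum>c\<in>C. scale (g (f c)) c) = 0"
      using g by (simp add: f_sum sum.reindex[OF inj])
    moreover have "(\<Sum>c\<in>C. scale (g (f c)) c) \<in> span B"
      using CB by (auto intro!: span_scale span_sum)
    ultimately have "(\<Sum>c\<in>C. scale (g (f c)) c) = 0"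
      by (rule ker[rotated])
    then show "g w = 0"
      using independentD[OF C(2) fC subset_refl, of "\<lambda>c. g (f c)"] c by blast
  qed
  have fCs: "f ` C \<subseteq> span C"
    using into CB sC by blast
  \<comment> \<open>A vector of \<open>span C\<close> outside the span of the images would give
    \<open>card C + 1\<close> independent vectors inside \<open>span C\<close>.\<close>
  have "span C \<subseteq> span (f ` C)"
  proof (rule ccontr)
    assume "\<not> ?thesis"
    then obtain w where w: "w \<in> span C" "w \<notin> span (f ` C)" by blast
    then have "independent (insert w (f ` C))"
      using ind by (simp add: independent_insertI)
    then have "card (insert w (f ` C)) \<le> card C"
      using independent_span_bound[OF fC] w fCs by blast
    moreover have "w \<notin> f ` C"
      using w(2) span_base by blast
    ultimately show False
      using fC by (simp add: card_image[OF inj])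
  qed
  moreover have "span (f ` C) \<subseteq> f ` span C"
  proof
    fix w assume "w \<in> span (f ` C)"
    then obtain r where "w = (\<Sum>x\<in>f ` C. scale (r x) x)"
      using fC by (auto simp: span_finite)
    then have "w = f (\<Sum>c\<in>C. scale (r (f c)) c)"
      by (simp add: f_sum sum.reindex[OF inj])
    moreover have "(\<Sum>c\<in>C. scale (r (f c)) c) \<in> span C"
      by (intro span_sum span_scale span_base)
    ultimately show "w \<in> f ` span C" by blast
  qed
  ultimately show "span B \<subseteq> f ` span B"
    using sC by blast
qed (rule into)

section \<open>Coefficient functions as a vector space\<close>

text \<open>The scalar action of \<open>FI X\<close> without reference to \<open>X\<close>, so that
  the whole function type becomes a vector space.\<close>

definition fun_scale :: "'k::field \<Rightarrow> ('x \<Rightarrow> 'x \<Rightarrow> 'k) \<Rightarrow> ('x \<Rightarrow> 'x \<Rightarrow> 'k)" where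
  "fun_scale c \<alpha> = (\<lambda>x y. c * \<alpha> x y)"

interpretation fun_vs: vector_space "fun_scale :: 'k::field \<Rightarrow> ('x \<Rightarrow> 'x \<Rightarrow> 'k) \<Rightarrow> _"
  by unfold_locales (auto simp: fun_scale_def algebra_simps fun_eq_iff)

text \<open>The space \<open>J\<close> of the overview; \<open>strictly_upper_iff\<close> below
  links it to the diagonal.\<close>

definition strictly_upper :: "'x::order set \<Rightarrow> ('x \<Rightarrow> 'x \<Rightarrow> 'k::field) set" where
  "strictly_upper X = {\<alpha>. \<forall>x y. \<alpha> x y \<noteq> 0 \<longrightarrow> x \<in> X \<and> y \<in> X \<and> x < y}"

definition matrix_unit :: "'x \<times> 'x \<Rightarrow> 'x \<Rightarrow> 'x \<Rightarrow> 'k::field" where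
  "matrix_unit p = (\<lambda>x y. if (x, y) = p then 1 else 0)"

lemma sum_fun_apply2: "(\<Sum>i\<in>A. f i) x y = (\<Sum>i\<in>A. f i x y)"
  for f :: "'i \<Rightarrow> 'a \<Rightarrow> 'b \<Rightarrow> 'c::comm_monoid_add"
  by (induction A rule: infinite_finite_induct) auto

lemma FI_sel [simp]:
  "carrier (FI X) = FI_carrier X"
  "\<alpha> \<otimes>\<^bsub>FI X\<^esub> \<beta> = FI_mult X \<alpha> \<beta>"
  "\<alpha> \<oplus>\<^bsub>FI X\<^esub> \<beta> = \<alpha> + \<beta>"
  "c \<odot>\<^bsub>FI X\<^esub> \<alpha> = fun_scale c \<alpha>"
  "\<one>\<^bsub>FI X\<^esub> = (\<lambda>x y. if x \<in> X \<and> x = y then 1 else 0)"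
  by (auto simp: FI_def fun_scale_def fun_eq_iff)

section \<open>The algebra \<open>FI X\<close> for finitely many strict pairs\<close>

context
  fixes X :: "'x::order set"
  assumes fin: "finite {(x, y) \<in> X \<times> X. x < y}"
begin

text \<open>The pairs in the finiteness condition of \<open>FI_carrier\<close> all lie in the finite
  set of \<open>fin\<close>.\<close>

lemma FI_carrier_iff: "\<alpha> \<in> FI_carrier X \<longleftrightarrow> (\<forall>x y. \<alpha> x y \<noteq> 0 \<longrightarrow> x \<in> X \<and> y \<in> X \<and> x \<le> y)"
proof -
  have "finite {(u, v). u \<in> X \<and> v \<in> X \<and> x \<le> u \<and> u < v \<and> v \<le> y \<and> \<alpha> u v \<noteq> 0}" for x y
    by (rule finite_subset[OF _ fin]) auto
  then show ?thesis by (simp add: FI_carrier_def)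
qed

lemma FI_carrierI:
  "(\<And>x y. \<not> (x \<in> X \<and> y \<in> X \<and> x \<le> y) \<Longrightarrow> \<alpha> x y = 0) \<Longrightarrow> \<alpha> \<in> FI_carrier X"
  unfolding FI_carrier_iff by blast

lemma FI_carrier_zero:
  "\<alpha> \<in> FI_carrier X \<Longrightarrow> \<not> (x \<in> X \<and> y \<in> X \<and> x \<le> y) \<Longrightarrow> \<alpha> x y = 0"
  unfolding FI_carrier_iff by blast

text \<open>Each \<open>z\<close> other than \<open>x\<close> is the second component of a strict
  pair.\<close>

lemma finite_interval: "x \<in> X \<Longrightarrow> finite {z \<in> X. x \<le> z \<and> z \<le> y}"
  by (rule finite_subset[of _ "insert x (snd ` {(x, y) \<in> X \<times> X. x < y})"])
    (use fin in \<open>force simp: order_le_less image_iff\<close>)+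

text \<open>A nonzero summand forces \<open>z\<close> into the interval, so a larger index set adds
  only zeros. This frees the index set from the factors, as needed for splitting and swapping
  sums.\<close>

lemma FI_mult_sum:
  assumes "\<alpha> \<in> FI_carrier X" "\<beta> \<in> FI_carrier X" "x \<in> X"
    and "finite I" "{z \<in> X. x \<le> z \<and> z \<le> y} \<subseteq> I"
  shows "FI_mult X \<alpha> \<beta> x y = (\<Sum>z\<in>I. \<alpha> x z * \<beta> z y)"
proof -
  have supp: "z \<in> X \<and> x \<le> z \<and> z \<le> y \<and> y \<in> X" if "\<alpha> x z * \<beta> z y \<noteq> 0" for z
    using assms(1,2) that unfolding FI_carrier_iff mult_eq_0_iff by blast
  show ?thesis
  proof (cases "y \<in> X \<and> x \<le> y")
    case True
    have "FI_mult X \<alpha> \<beta> x y =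
        (\<Sum>z | z \<in> X \<and> x \<le> z \<and> z \<le> y \<and> \<alpha> x z * \<beta> z y \<noteq> 0. \<alpha> x z * \<beta> z y)"
      using True assms(3) by (simp add: FI_mult_def)
    also have "\<dots> = (\<Sum>z\<in>I. \<alpha> x z * \<beta> z y)"
    proof (rule sum.mono_neutral_left[OF \<open>finite I\<close>])
      show "\<forall>z\<in>I - {z \<in> X. x \<le> z \<and> z \<le> y \<and> \<alpha> x z * \<beta> z y \<noteq> 0}. \<alpha> x z * \<beta> z y = 0"
        using supp by blast
    qed (use assms(5) in blast)
    finally show ?thesis .
  next
    case False
    then have "\<alpha> x z * \<beta> z y = 0" for z
      using supp[of z] order_trans[of x z y] by blast
    then have "(\<Sum>z\<in>I. \<alpha> x z * \<beta> z y) = 0"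
      by (rule sum.neutral[rule_format])
    moreover have "FI_mult X \<alpha> \<beta> x y = 0"
      using False unfolding FI_mult_def by argo
    ultimately show ?thesis by simp
  qed
qed

lemma FI_mult_closed: "FI_mult X \<alpha> \<beta> \<in> FI_carrier X"
  by (rule FI_carrierI) (auto simp: FI_mult_def)

lemma FI_mult_diag:
  assumes "\<alpha> \<in> FI_carrier X" "\<beta> \<in> FI_carrier X" "x \<in> X"
  shows "FI_mult X \<alpha> \<beta> x x = \<alpha> x x * \<beta> x x"
proof -
  have "FI_mult X \<alpha> \<beta> x x = (\<Sum>z\<in>{x}. \<alpha> x z * \<beta> z x)"
    by (rule FI_mult_sum[OF assms]) auto
  then show ?thesis by simp
qed

lemma FI_mult_assoc:
  assumes "\<alpha> \<in> FI_carrier X" "\<beta> \<in> FI_carrier X" "\<gamma> \<in> FI_carrier X"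
  shows "FI_mult X (FI_mult X \<alpha> \<beta>) \<gamma> = FI_mult X \<alpha> (FI_mult X \<beta> \<gamma>)"
proof (intro ext)
  fix x y
  show "FI_mult X (FI_mult X \<alpha> \<beta>) \<gamma> x y = FI_mult X \<alpha> (FI_mult X \<beta> \<gamma>) x y"
  proof (cases "x \<in> X")
    case True
    \<comment> \<open>One index set serves all sums: the inner ones run over subintervals of
      \<open>I\<close> and are extended to \<open>I\<close> by zeros.\<close>
    define I where "I = {z \<in> X. x \<le> z \<and> z \<le> y}"
    have I: "finite I" using finite_interval[OF True] by (simp add: I_def)
    have l: "FI_mult X \<alpha> \<beta> x z = (\<Sum>w\<in>I. \<alpha> x w * \<beta> w z)" if "z \<in> I" for z
    proof (rule FI_mult_sum[OF assms(1,2) True I])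
      show "{w \<in> X. x \<le> w \<and> w \<le> z} \<subseteq> I"
        using that unfolding I_def by (blast intro: order_trans)
    qed
    have r: "FI_mult X \<beta> \<gamma> w y = (\<Sum>z\<in>I. \<beta> w z * \<gamma> z y)" if "w \<in> I" for w
    proof (rule FI_mult_sum[OF assms(2,3) _ I])
      show "w \<in> X" "{z \<in> X. w \<le> z \<and> z \<le> y} \<subseteq> I"
        using that unfolding I_def by (blast intro: order_trans)+
    qed
    have "FI_mult X (FI_mult X \<alpha> \<beta>) \<gamma> x y = (\<Sum>z\<in>I. (\<Sum>w\<in>I. \<alpha> x w * \<beta> w z) * \<gamma> z y)"
      using FI_mult_sum[OF FI_mult_closed assms(3) True I] l unfolding I_def by simp
    also have "\<dots> = (\<Sum>w\<in>I. \<alpha> x w * (\<Sum>z\<in>I. \<beta> w z * \<gamma> z y))"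
      unfolding sum_distrib_left sum_distrib_right mult.assoc by (rule sum.swap)
    also have "\<dots> = FI_mult X \<alpha> (FI_mult X \<beta> \<gamma>) x y"
      using FI_mult_sum[OF assms(1) FI_mult_closed True I] r unfolding I_def by simp
    finally show ?thesis .
  qed (simp add: FI_mult_def)
qed

lemma FI_one_closed: "\<one>\<^bsub>FI X\<^esub> \<in> FI_carrier X"
  by (rule FI_carrierI) auto

lemma FI_add_closed: "\<alpha> \<in> FI_carrier X \<Longrightarrow> \<beta> \<in> FI_carrier X \<Longrightarrow> \<alpha> + \<beta> \<in> FI_carrier X"
  by (rule FI_carrierI) (simp add: FI_carrier_zero)

lemma FI_scale_closed: "\<alpha> \<in> FI_carrier X \<Longrightarrow> fun_scale c \<alpha> \<in> FI_carrier X"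
  by (rule FI_carrierI) (simp add: FI_carrier_zero fun_scale_def)

lemma FI_diff_closed: "\<alpha> \<in> FI_carrier X \<Longrightarrow> \<beta> \<in> FI_carrier X \<Longrightarrow> \<alpha> - \<beta> \<in> FI_carrier X"
  by (rule FI_carrierI) (simp add: FI_carrier_zero)

lemma FI_mult_one_left:
  assumes "\<alpha> \<in> FI_carrier X" shows "FI_mult X \<one>\<^bsub>FI X\<^esub> \<alpha> = \<alpha>"
proof (intro ext)
  fix x y
  show "FI_mult X \<one>\<^bsub>FI X\<^esub> \<alpha> x y = \<alpha> x y"
  proof (cases "x \<in> X \<and> y \<in> X \<and> x \<le> y")
    case True
    then have "FI_mult X \<one>\<^bsub>FI X\<^esub> \<alpha> x y = (\<Sum>z | z \<in> X \<and> x \<le> z \<and> z \<le> y. \<one>\<^bsub>FI X\<^esub> x z * \<alpha> z y)"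
      by (intro FI_mult_sum FI_one_closed assms finite_interval) auto
    also have "\<dots> = (\<Sum>z\<in>{x}. \<one>\<^bsub>FI X\<^esub> x z * \<alpha> z y)"
      using True by (intro sum.mono_neutral_right finite_interval) auto
    finally show ?thesis using True by simp
  qed (auto simp: FI_mult_def FI_carrier_zero[OF assms])
qed

lemma FI_mult_one_right:
  assumes "\<alpha> \<in> FI_carrier X" shows "FI_mult X \<alpha> \<one>\<^bsub>FI X\<^esub> = \<alpha>"
proof (intro ext)
  fix x y
  show "FI_mult X \<alpha> \<one>\<^bsub>FI X\<^esub> x y = \<alpha> x y"
  proof (cases "x \<in> X \<and> y \<in> X \<and> x \<le> y")
    case True
    then have "FI_mult X \<alpha> \<one>\<^bsub>FI X\<^esub> x y = (\<Sum>z | z \<in> X \<and> x \<le> z \<and> z \<le> y. \<alpha> x z * \<one>\<^bsub>FI X\<^esub> z y)"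
      by (intro FI_mult_sum FI_one_closed assms finite_interval) auto
    also have "\<dots> = (\<Sum>z\<in>{y}. \<alpha> x z * \<one>\<^bsub>FI X\<^esub> z y)"
      using True by (intro sum.mono_neutral_right finite_interval) auto
    finally show ?thesis using True by simp
  qed (auto simp: FI_mult_def FI_carrier_zero[OF assms])
qed

text \<open>With \<open>FI_mult_scale_right\<close> this makes left multiplication by a fixed
  element a linear map, to which the surjectivity result is applied in
  \<open>Units_FI_iff\<close>.\<close>

lemma FI_mult_add_right:
  assumes "\<alpha> \<in> FI_carrier X" "\<beta> \<in> FI_carrier X" "\<gamma> \<in> FI_carrier X"
  shows "FI_mult X \<alpha> (\<beta> + \<gamma>) = FI_mult X \<alpha> \<beta> + FI_mult X \<alpha> \<gamma>"
proof (intro ext)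
  fix x y
  show "FI_mult X \<alpha> (\<beta> + \<gamma>) x y = (FI_mult X \<alpha> \<beta> + FI_mult X \<alpha> \<gamma>) x y"
  proof (cases "x \<in> X")
    case True
    note s = FI_mult_sum[OF assms(1) _ True finite_interval[OF True] order_refl]
    show ?thesis
      using assms by (simp add: s FI_add_closed sum.distrib distrib_left)
  qed (simp add: FI_mult_def)
qed

lemma FI_mult_scale_right:
  assumes "\<alpha> \<in> FI_carrier X" "\<beta> \<in> FI_carrier X"
  shows "FI_mult X \<alpha> (fun_scale c \<beta>) = fun_scale c (FI_mult X \<alpha> \<beta>)"
proof (intro ext)
  fix x y
  show "FI_mult X \<alpha> (fun_scale c \<beta>) x y = fun_scale c (FI_mult X \<alpha> \<beta>) x y"
  proof (cases "x \<in> X")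
    case True
    note s = FI_mult_sum[OF assms(1) _ True finite_interval[OF True] order_refl]
    show ?thesis
      using assms s[OF FI_scale_closed[OF assms(2)]] s[OF assms(2)]
      by (simp add: fun_scale_def sum_distrib_left mult.left_commute)
  qed (simp add: FI_mult_def fun_scale_def)
qed

section \<open>Elements with zero diagonal\<close>

lemma strictly_upper_iff: "\<alpha> \<in> strictly_upper X \<longleftrightarrow> \<alpha> \<in> FI_carrier X \<and> (\<forall>x\<in>X. \<alpha> x x = 0)"
  by (auto simp: strictly_upper_def FI_carrier_iff order_less_le)

text \<open>Exhibits \<open>J\<close> as finite-dimensional: \<open>fin\<close> bounds the number of
  matrix units.\<close>

lemma span_matrix_units:
  "fun_vs.span (matrix_unit ` {(x, y) \<in> X \<times> X. x < y}) = (strictly_upper X :: ('x \<Rightarrow> 'x \<Rightarrow> 'k::field) set)"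
  (is "fun_vs.span (_ ` ?P) = _")
proof
  have "fun_vs.subspace (strictly_upper X :: ('x \<Rightarrow> 'x \<Rightarrow> 'k) set)"
    unfolding fun_vs.subspace_def strictly_upper_def fun_scale_def
    by (auto) (metis add.right_neutral)+
  then show "fun_vs.span (matrix_unit ` ?P) \<subseteq> (strictly_upper X :: ('x \<Rightarrow> 'x \<Rightarrow> 'k) set)"
    by (rule fun_vs.span_minimal[rotated])
      (auto simp: strictly_upper_def matrix_unit_def split: if_splits)
  show "(strictly_upper X :: ('x \<Rightarrow> 'x \<Rightarrow> 'k) set) \<subseteq> fun_vs.span (matrix_unit ` ?P)"
  proof
    fix \<alpha> :: "'x \<Rightarrow> 'x \<Rightarrow> 'k" assume \<alpha>: "\<alpha> \<in> strictly_upper X"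
    have "\<alpha> = (\<Sum>p\<in>?P. fun_scale (\<alpha> (fst p) (snd p)) (matrix_unit p))"
    proof (intro ext)
      fix x y
      have "(\<Sum>p\<in>?P. fun_scale (\<alpha> (fst p) (snd p)) (matrix_unit p)) x y
          = (\<Sum>p\<in>?P. if p = (x, y) then \<alpha> x y else 0)"
        unfolding sum_fun_apply2
        by (rule sum.cong) (auto simp: fun_scale_def matrix_unit_def)
      also have "\<dots> = (if (x, y) \<in> ?P then \<alpha> x y else 0)"
        using fin by (simp add: sum.delta)
      also have "\<dots> = \<alpha> x y"
        using \<alpha> by (auto simp: strictly_upper_def)
      finally show "\<alpha> x y = (\<Sum>p\<in>?P. fun_scale (\<alpha> (fst p) (snd p)) (matrix_unit p)) x y"
        by simp
    qed
    also have "\<dots> \<in> fun_vs.span (matrix_unit ` ?P)"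
      by (intro fun_vs.span_sum fun_vs.span_scale fun_vs.span_base) blast
    finally show "\<alpha> \<in> fun_vs.span (matrix_unit ` ?P)" .
  qed
qed

text \<open>Used twice: for left multiplication by an element with nonzero diagonal, and for \<phi>
  itself.\<close>

lemma injective_endo_surj_on_strictly_upper:
  fixes f :: "('x \<Rightarrow> 'x \<Rightarrow> 'k::field) \<Rightarrow> ('x \<Rightarrow> 'x \<Rightarrow> 'k)"
  assumes "\<And>u v. u \<in> strictly_upper X \<Longrightarrow> v \<in> strictly_upper X \<Longrightarrow> f (u + v) = f u + f v"
    and "\<And>c u. u \<in> strictly_upper X \<Longrightarrow> f (fun_scale c u) = fun_scale c (f u)"
    and "f ` strictly_upper X \<subseteq> strictly_upper X"
    and "\<And>u. u \<in> strictly_upper X \<Longrightarrow> f u = 0 \<Longrightarrow> u = 0"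
  shows "f ` strictly_upper X = strictly_upper X"
  using fun_vs.injective_endo_surj_on_span[of "matrix_unit ` {(x, y) \<in> X \<times> X. x < y}" f] assms fin
  unfolding span_matrix_units by blast

section \<open>Units and the diagonal\<close>

text \<open>In a maximal nonzero row \<open>x\<close> of \<nu>, the product has the entries
  \<open>\<alpha> x x * \<nu> x y\<close>, because all rows of \<nu> strictly above \<open>x\<close>
  vanish.\<close>

lemma FI_mult_strictly_upper_eq_0:
  assumes \<alpha>: "\<alpha> \<in> FI_carrier X" and d: "\<And>x. x \<in> X \<Longrightarrow> \<alpha> x x \<noteq> 0"
    and \<nu>: "\<nu> \<in> strictly_upper X" and 0: "FI_mult X \<alpha> \<nu> = 0"
  shows "\<nu> = 0"
proof (rule ccontr)
  assume "\<nu> \<noteq> 0"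
  let ?S = "{x. \<exists>y. \<nu> x y \<noteq> 0}"
  \<comment> \<open>Nonzero rows start strict pairs, so there are finitely many and a maximal one
    exists.\<close>
  have "?S \<subseteq> Domain {(x, y) \<in> X \<times> X. x < y}"
    using \<nu> unfolding strictly_upper_def by blast
  then have "finite ?S"
    by (rule finite_subset[OF _ finite_Domain[OF fin]])
  moreover have "?S \<noteq> {}"
    using \<open>\<nu> \<noteq> 0\<close> by (auto simp: fun_eq_iff)
  ultimately have "\<exists>x\<in>?S. \<forall>z\<in>?S. x \<le> z \<longrightarrow> x = z"
    by (rule finite_has_maximal)
  then obtain x where x: "x \<in> ?S" "\<And>z. z \<in> ?S \<Longrightarrow> x \<le> z \<Longrightarrow> x = z"
    by blast
  then obtain y where y: "\<nu> x y \<noteq> 0" by blast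
  then have xy: "x \<in> X" "y \<in> X" "x \<le> y"
    using \<nu> unfolding strictly_upper_def by (blast intro: order_less_imp_le)+
  have \<nu>': "\<nu> \<in> FI_carrier X" using \<nu> by (simp add: strictly_upper_iff)
  have "FI_mult X \<alpha> \<nu> x y = (\<Sum>z | z \<in> X \<and> x \<le> z \<and> z \<le> y. \<alpha> x z * \<nu> z y)"
    by (rule FI_mult_sum[OF \<alpha> \<nu>' xy(1) finite_interval[OF xy(1)] order_refl])
  also have "\<dots> = (\<Sum>z\<in>{x}. \<alpha> x z * \<nu> z y)"
  proof (rule sum.mono_neutral_right[OF finite_interval[OF xy(1)]])
    show "\<forall>z\<in>{z \<in> X. x \<le> z \<and> z \<le> y} - {x}. \<alpha> x z * \<nu> z y = 0"
      using x(2) by fastforce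
  qed (use xy in simp)
  finally show False
    using 0 y d[OF xy(1)] by (simp add: fun_eq_iff)
qed

text \<open>Diagonals multiply entrywise, which gives one direction. For the other, left
  multiplication by \<alpha> is injective on \<open>J\<close>, hence onto \<open>J\<close>; this
  corrects a diagonal inverse to a right inverse, and injectivity then makes it two-sided.\<close>

lemma Units_FI_iff:
  fixes \<alpha> :: "'x \<Rightarrow> 'x \<Rightarrow> 'k::field"
  assumes \<alpha>: "\<alpha> \<in> FI_carrier X"
  shows "\<alpha> \<in> Units (FI X) \<longleftrightarrow> (\<forall>x\<in>X. \<alpha> x x \<noteq> 0)"
proof
  assume "\<alpha> \<in> Units (FI X)"
  then obtain \<beta> where \<beta>: "\<beta> \<in> FI_carrier X" "FI_mult X \<alpha> \<beta> = \<one>\<^bsub>FI X\<^esub>"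
    unfolding Units_def by auto
  show "\<forall>x\<in>X. \<alpha> x x \<noteq> 0"
    using FI_mult_diag[OF \<alpha> \<beta>(1)] \<beta>(2) by fastforce
next
  assume d: "\<forall>x\<in>X. \<alpha> x x \<noteq> 0"
  let ?one = "\<one>\<^bsub>FI X\<^esub> :: 'x \<Rightarrow> 'x \<Rightarrow> 'k"
  \<comment> \<open>\<open>D\<close> inverts \<alpha> on the diagonal, so the error
    \<open>1 - \<alpha> D\<close> lies in \<open>J\<close> and equals \<open>\<alpha> \<nu>\<close>
    for some \<nu> in \<open>J\<close>.\<close>
  define D where "D = (\<lambda>x y. if x \<in> X \<and> x = y then inverse (\<alpha> x x) else 0)"
  have D: "D \<in> FI_carrier X" by (rule FI_carrierI) (auto simp: D_def)
  have Dd: "D x x = inverse (\<alpha> x x)" if "x \<in> X" for x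
    using that by (simp add: D_def)
  have diff: "?one - FI_mult X \<alpha> D \<in> strictly_upper X"
    unfolding strictly_upper_iff
    using FI_diff_closed[OF FI_one_closed FI_mult_closed] d
    by (simp add: FI_mult_diag[OF \<alpha> D] Dd)
  have "FI_mult X \<alpha> ` strictly_upper X = strictly_upper X"
    using d by (intro injective_endo_surj_on_strictly_upper)
      (auto simp: FI_mult_add_right FI_mult_scale_right FI_mult_closed FI_mult_diag \<alpha>
        strictly_upper_iff intro!: FI_mult_strictly_upper_eq_0[OF \<alpha>])
  then obtain \<nu> where \<nu>: "\<nu> \<in> strictly_upper X" "FI_mult X \<alpha> \<nu> = ?one - FI_mult X \<alpha> D"
    using diff by (metis imageE)
  have \<nu>': "\<nu> \<in> FI_carrier X" using \<nu> by (simp add: strictly_upper_iff)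
  define \<beta> where "\<beta> = D + \<nu>"
  have \<beta>: "\<beta> \<in> FI_carrier X" by (simp add: \<beta>_def FI_add_closed D \<nu>')
  have r: "FI_mult X \<alpha> \<beta> = ?one"
    using \<nu>(2) by (simp add: \<beta>_def FI_mult_add_right \<alpha> D \<nu>')
  \<comment> \<open>The defect \<open>\<beta> \<alpha> - 1\<close>: its diagonal is zero by
    commutativity of the field, and \<alpha> annihilates it from the left since
    \<open>\<alpha> \<beta> = 1\<close>.\<close>
  define \<mu> where "\<mu> = FI_mult X \<beta> \<alpha> + fun_scale (-1) ?one"
  have \<mu>: "\<mu> \<in> FI_carrier X"
    unfolding \<mu>_def by (intro FI_add_closed FI_mult_closed FI_scale_closed FI_one_closed)
  have "\<mu> x x = 0" if "x \<in> X" for x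
    using FI_mult_diag[OF \<alpha> \<beta> that] FI_mult_diag[OF \<beta> \<alpha> that] r that
    by (simp add: \<mu>_def fun_scale_def mult.commute)
  then have "\<mu> \<in> strictly_upper X"
    using \<mu> by (simp add: strictly_upper_iff)
  moreover have "FI_mult X \<alpha> \<mu> = 0"
  proof -
    have "FI_mult X \<alpha> \<mu> = FI_mult X \<alpha> (FI_mult X \<beta> \<alpha>) + fun_scale (-1) (FI_mult X \<alpha> ?one)"
      unfolding \<mu>_def using \<alpha>
      by (simp only: FI_mult_add_right FI_mult_scale_right FI_mult_closed FI_scale_closed FI_one_closed)
    also have "FI_mult X \<alpha> (FI_mult X \<beta> \<alpha>) = \<alpha>"
      using FI_mult_assoc[OF \<alpha> \<beta> \<alpha>] r FI_mult_one_left[OF \<alpha>] by metis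
    also have "FI_mult X \<alpha> ?one = \<alpha>" by (rule FI_mult_one_right[OF \<alpha>])
    finally show ?thesis by (simp add: fun_scale_def fun_eq_iff)
  qed
  ultimately have "\<mu> = 0"
    using FI_mult_strictly_upper_eq_0[OF \<alpha>] d by blast
  then have "FI_mult X \<beta> \<alpha> = ?one"
    by (simp add: \<mu>_def fun_scale_def fun_eq_iff)
  with r \<alpha> \<beta> show "\<alpha> \<in> Units (FI X)"
    unfolding Units_def by auto
qed

section \<open>Linear invertibility preservers\<close>

lemma unit_preserver_strictly_upper:
  fixes \<phi> :: "('x \<Rightarrow> 'x \<Rightarrow> 'k::field) \<Rightarrow> ('x \<Rightarrow> 'x \<Rightarrow> 'k)"
  assumes inv: "invertibility_preserver (FI X) \<phi>" and lin: "linear_endo (FI X) \<phi>"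
    and \<nu>: "\<nu> \<in> strictly_upper X"
  shows "\<phi> \<nu> \<in> strictly_upper X"
proof -
  let ?one = "\<one>\<^bsub>FI X\<^esub> :: 'x \<Rightarrow> 'x \<Rightarrow> 'k"
  have \<nu>': "\<nu> \<in> FI_carrier X" "\<And>x. x \<in> X \<Longrightarrow> \<nu> x x = 0"
    using \<nu> by (auto simp: strictly_upper_iff)
  have closed: "\<phi> \<alpha> \<in> FI_carrier X" if "\<alpha> \<in> FI_carrier X" for \<alpha>
    using lin that by (auto simp: linear_endo_def)
  have "\<phi> \<nu> x x = 0" if x: "x \<in> X" for x
  proof (rule ccontr)
    assume n: "\<phi> \<nu> x x \<noteq> 0"
    \<comment> \<open>The zero of the affine function
      \<open>t \<mapsto> \<phi> (1 + t \<nu>) x x\<close>, while \<open>1 + t \<nu>\<close> has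
      diagonal 1 and is a unit.\<close>
    define t where "t = - \<phi> ?one x x / \<phi> \<nu> x x"
    let ?u = "?one + fun_scale t \<nu>"
    have u: "?u \<in> FI_carrier X"
      by (intro FI_add_closed FI_scale_closed FI_one_closed \<nu>')
    moreover have "?u z z \<noteq> 0" if "z \<in> X" for z
      using that \<nu>'(2) by (simp add: fun_scale_def)
    ultimately have "\<phi> ?u \<in> Units (FI X)"
      using inv Units_FI_iff[OF u] unfolding invertibility_preserver_def by blast
    then have "\<phi> ?u x x \<noteq> 0"
      using Units_FI_iff[OF closed[OF u]] x by blast
    moreover have "\<phi> ?u = \<phi> ?one + fun_scale t (\<phi> \<nu>)"
      using lin FI_one_closed FI_scale_closed[OF \<nu>'(1)] \<nu>'(1) unfolding linear_endo_def FI_sel(1,3,4)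
      by metis
    ultimately show False
      using n by (simp add: fun_scale_def t_def)
  qed
  then show ?thesis
    using closed[OF \<nu>'(1)] by (simp add: strictly_upper_iff)
qed

text \<open>Since \<phi> maps \<open>J\<close> onto \<open>J\<close> and is injective, no element
  outside \<open>J\<close> can enter \<open>J\<close>. This supplies the diagonal position at which
  the affine argument runs.\<close>

lemma linear_unit_preserver_reflects_units:
  fixes \<phi> :: "('x \<Rightarrow> 'x \<Rightarrow> 'k::field) \<Rightarrow> ('x \<Rightarrow> 'x \<Rightarrow> 'k)"
  assumes inv: "invertibility_preserver (FI X) \<phi>" and lin: "linear_endo (FI X) \<phi>"
    and inj: "inj_on \<phi> (FI_carrier X)"
    and a: "a \<in> FI_carrier X" and unit: "\<phi> a \<in> Units (FI X)"
  shows "a \<in> Units (FI X)"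
proof (rule ccontr)
  assume "a \<notin> Units (FI X)"
  then obtain s where s: "s \<in> X" "a s s = 0"
    using Units_FI_iff[OF a] by blast
  have add: "\<phi> (\<alpha> + \<beta>) = \<phi> \<alpha> + \<phi> \<beta>" if "\<alpha> \<in> FI_carrier X" "\<beta> \<in> FI_carrier X" for \<alpha> \<beta>
    using lin that by (simp add: linear_endo_def)
  have scl: "\<phi> (fun_scale c \<alpha>) = fun_scale c (\<phi> \<alpha>)" if "\<alpha> \<in> FI_carrier X" for c \<alpha>
    using lin that by (simp add: linear_endo_def)
  have closed: "\<phi> \<alpha> \<in> FI_carrier X" if "\<alpha> \<in> FI_carrier X" for \<alpha>
    using lin that by (auto simp: linear_endo_def)
  have su: "\<alpha> \<in> FI_carrier X" if "\<alpha> \<in> strictly_upper X" for \<alpha> :: "'x \<Rightarrow> 'x \<Rightarrow> 'k"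
    using that by (simp add: strictly_upper_iff)
  have zero: "0 \<in> FI_carrier X" "\<phi> 0 = 0"
    using scl[of 0 0] by (simp_all add: FI_carrierI fun_scale_def zero_fun_def)
  have "u = 0" if "u \<in> strictly_upper X" "\<phi> u = 0" for u
    using inj_onD[OF inj] zero su that by metis
  then have onto: "\<phi> ` strictly_upper X = strictly_upper X"
    by (intro injective_endo_surj_on_strictly_upper)
      (auto intro: add scl su unit_preserver_strictly_upper[OF inv lin])
  \<comment> \<open>The position \<open>s\<close> makes \<open>b\<close> nonzero on the diagonal, so
    \<open>b\<close> is not in \<open>J\<close>.\<close>
  define b :: "'x \<Rightarrow> 'x \<Rightarrow> 'k" where "b = (\<lambda>x y. if x \<in> X \<and> x = y \<and> a x x = 0 then 1 else 0)"
  have b: "b \<in> FI_carrier X" by (rule FI_carrierI) (auto simp: b_def)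
  have "\<phi> b \<notin> strictly_upper X"
  proof
    assume "\<phi> b \<in> strictly_upper X"
    then obtain \<nu> where "\<nu> \<in> strictly_upper X" "\<phi> \<nu> = \<phi> b"
      using onto by (metis imageE)
    then have "b \<in> strictly_upper X"
      using inj b su by (metis inj_onD)
    then show False
      using s by (auto simp: strictly_upper_iff b_def)
  qed
  then obtain x where x: "x \<in> X" "\<phi> b x x \<noteq> 0"
    using closed[OF b] by (auto simp: strictly_upper_iff)
  define t where "t = - \<phi> a x x / \<phi> b x x"
  \<comment> \<open>As \<open>\<phi> a\<close> is a unit, its entry at \<open>x\<close> is
    nonzero.\<close>
  have "t \<noteq> 0"
    using unit Units_FI_iff[OF closed[OF a]] x by (auto simp: t_def)
  let ?u = "a + fun_scale t b"
  have u: "?u \<in> FI_carrier X"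
    by (intro FI_add_closed FI_scale_closed a b)
  \<comment> \<open>The entry is \<open>t\<close> where the diagonal of \<open>a\<close> vanishes,
    and \<open>a z z\<close> elsewhere.\<close>
  moreover have "?u z z \<noteq> 0" if "z \<in> X" for z
    using that \<open>t \<noteq> 0\<close> by (simp add: fun_scale_def b_def)
  ultimately have "\<phi> ?u \<in> Units (FI X)"
    using inv Units_FI_iff[OF u] unfolding invertibility_preserver_def by blast
  then have "\<phi> ?u x x \<noteq> 0"
    using Units_FI_iff[OF closed[OF u]] x by blast
  moreover have "\<phi> ?u = \<phi> a + fun_scale t (\<phi> b)"
    by (simp add: add scl FI_scale_closed a b)
  ultimately show False
    using x(2) by (simp add: fun_scale_def t_def)
qed

end

theorem mainTheorem5:
  fixes X :: "'x::order set"
    and \<phi> :: "('x \<Rightarrow> 'x \<Rightarrow> 'k::field) \<Rightarrow> ('x \<Rightarrow> 'x \<Rightarrow> 'k)"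
  assumes "finite {(x, y) \<in> X \<times> X. x < y}"
    and "invertibility_preserver (FI X) \<phi>"
    and "unital_map (FI X) \<phi>"
    and "bij_betw \<phi> (carrier (FI X)) (carrier (FI X))"
    and "linear_endo (FI X) \<phi>"
  shows "strong_invertibility_preserver (FI X) \<phi>"
proof -
  have "a \<in> Units (FI X) \<longleftrightarrow> \<phi> a \<in> Units (FI X)" if "a \<in> carrier (FI X)" for a
  proof
    show "\<phi> a \<in> Units (FI X)" if "a \<in> Units (FI X)"
      using assms(2) that unfolding invertibility_preserver_def by blast
    show "a \<in> Units (FI X)" if "\<phi> a \<in> Units (FI X)"
      using linear_unit_preserver_reflects_units[OF assms(1,2,5) _ _ that] assms(4)
        \<open>a \<in> carrier (FI X)\<close>
      by (simp add: bij_betw_def)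
  qed
  then show ?thesis
    using assms(2) unfolding strong_invertibility_preserver_def by blast
qed

end
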